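(* Let $K\ge1$ be an integer, let $m_{\max},N_{\mathrm{th}}>0$ be real, and let $\rho=N_{\mathrm{th}}/m_{\max}$ satisfy $\rho>F_{1,K+2}$. For each integer seed $d\ge1$ set $$\zeta_d=\left\lceil\frac{\rho-F_{d,K}}{F_{d,K+1}}\right\rceil,\qquad \Gamma_1(d)=\zeta_dF_{d,K+1}+F_{d,K},\qquad \Gamma_2(d)=\Gamma_1(d)+F_{d,K+1}.$$ (i) (Remainder chain and dynamic range.) The pair $(\Gamma_1(d),\Gamma_2(d))$ is coprime with $\Gamma_1(d)\ge\rho$, and its Euclidean remainders are $$\sigma_j=F_{d,K+2-j},\qquad 1\le j\le K+1.$$ The dynamic-range breakpoints $P_j$ of the two-moduli system $m_1=m\Gamma_1(d)$, $m_2=m\Gamma_2(d)$ are, for $1\le j\le K$, $$P_j=\begin{cases} m\,\Gamma_1(d)\,F_{\zeta_d,\,2j_0}, & j=2j_0-1,\\ m\,\Gamma_2(d)\,F_{\zeta_d-1,\,2j_0+1}, & j=2j_0,\end{cases}$$ and $P_{K+1}=\Gamma_1(d)\Gamma_2(d)\,m$. Robust recovery holds for $x\in[0,P_j)$ when $|e_1-e_2|<m\sigma_j/2$. (ii) (Optimal seed selection.) Within the family $(\Gamma_1(d),\Gamma_2(d))$, $d\ge1$, the minimal $\Gamma_2$ is obtained via $$(\Gamma_1^\star,\Gamma_2^\star)=\arg\min_{1\le d\le3}\Gamma_2(d),$$ i.e. no seed $d>3$ yields a smaller value of $\Gamma_2(d)$ than the minimum over $d\in\{1,2,3\}$; thus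 $m=m_{\max}/\Gamma_2^\star$ is maximized over the family.
   Context: **Fibonacci-like sequence.** For an integer $d\ge0$, $F_{d,0}=d$, $F_{d,1}=1$, and $F_{d,k}=F_{d,k-1}+F_{d,k-2}$ for $k\ge2$. **Two-moduli system.** For coprime positive integers $\Gamma_1<\Gamma_2$ and real $m>0$ (the scaling factor; the modulus bound $m_2\le m_{\max}$ is met with $m=m_{\max}/\Gamma_2$), the moduli are $m_1=m\Gamma_1$, $m_2=m\Gamma_2$. A real $x\ge0$ has folding integers $n_i=\lfloor x/m_i\rfloor$ and remainders $r_i=x-n_im_i$; one observes noisy remainders $\tilde r_i=r_i+e_i$, $i=1,2$, with real errors $e_i$. **Euclidean remainders.** $\sigma_{-1}=\Gamma_2$, $\sigma_0=\Gamma_1$, $\sigma_j=\sigma_{j-2}\bmod\sigma_{j-1}$ for $j\ge1$; the number $K$ of robust layers is the index for which $\sigma_{K+1}=1$. **Dynamic-range breakpoints.** $P_j=mN_j$ for $1\le j\le K+1$, where $N_{-1}=\Gamma_1$, $N_0=\Gamma_2$ and $$N_j=N_{j-2}+\left\lfloor\frac{\sigma_{j-1}}{\sigma_j}\right\rfloor(N_{j-1}-\sigma_j),\qquad j\ge1.$$ **Robust recovery** for $x\in[0,P_j)$ under an error condition means that for every $x\in[0,P_j)$ and all errors satisfying that condition, the folding integers $(n_1,n_2)$ of $x$ are uniquely determined by the noisy remainders $(\tilde r_1,\tilde r_2)$ (given that $x\in[0,P_j)$ and that the errors satisfy the condition).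
   Formalization: The remainder chain, breakpoint formulas and robust recovery in (i) are stated only for seeds d with ζ_d ≥ 1; for ζ_d = 0 the claim fails (K=2, ρ=6, d=5 gives the pair (6,13) with σ_1=1, not F_{5,3}=7). The condition always holds for d=1,2,3. *)

theory Defs
  imports Complex_Main
begin

fun fib_like :: "int \<Rightarrow> nat \<Rightarrow> int" where
  "fib_like d 0 = d"
| "fib_like d (Suc 0) = 1"
| "fib_like d (Suc (Suc k)) = fib_like d (Suc k) + fib_like d k"

(* sigma_j for j >= 0.  The remaining initial value sigma_{-1} = G2 is substituted
   directly into the clause for j = 1. *)
fun euclid_rem :: "int \<Rightarrow> int \<Rightarrow> nat \<Rightarrow> int" where
  "euclid_rem G1 G2 0 = G1"
| "euclid_rem G1 G2 (Suc 0) = G2 mod G1"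
| "euclid_rem G1 G2 (Suc (Suc j)) = euclid_rem G1 G2 j mod euclid_rem G1 G2 (Suc j)"

(* N_j for j >= 0, with N_{-1} = G1 substituted into the clause for j = 1.
   On int, div is the floor of the quotient. *)
fun range_coeff :: "int \<Rightarrow> int \<Rightarrow> nat \<Rightarrow> int" where
  "range_coeff G1 G2 0 = G2"
| "range_coeff G1 G2 (Suc 0) =
     G1 + (euclid_rem G1 G2 0 div euclid_rem G1 G2 (Suc 0)) * (G2 - euclid_rem G1 G2 (Suc 0))"
| "range_coeff G1 G2 (Suc (Suc j)) =
     range_coeff G1 G2 j
     + (euclid_rem G1 G2 (Suc j) div euclid_rem G1 G2 (Suc (Suc j)))
       * (range_coeff G1 G2 (Suc j) - euclid_rem G1 G2 (Suc (Suc j)))"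

definition breakpoint :: "real \<Rightarrow> int \<Rightarrow> int \<Rightarrow> nat \<Rightarrow> real" where
  "breakpoint m G1 G2 j = m * of_int (range_coeff G1 G2 j)"

definition folding :: "real \<Rightarrow> real \<Rightarrow> int" where
  "folding M x = \<lfloor>x / M\<rfloor>"

definition remainder :: "real \<Rightarrow> real \<Rightarrow> real" where
  "remainder M x = x - of_int (folding M x) * M"

(* Unique determination: two scenarios, each in the range and each satisfying the error
   condition, that produce the same noisy remainders have the same folding integers. *)
definition robust_recovery ::
  "real \<Rightarrow> real \<Rightarrow> real \<Rightarrow> (real \<Rightarrow> real \<Rightarrow> bool) \<Rightarrow> bool" where
  "robust_recovery m1 m2 P C \<longleftrightarrow>
     (\<forall>x \<in> {0..<P}. \<forall>y \<in> {0..<P}. \<forall>e1 e2 e1' e2'.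
        C e1 e2 \<longrightarrow> C e1' e2' \<longrightarrow>
        remainder m1 x + e1 = remainder m1 y + e1' \<longrightarrow>
        remainder m2 x + e2 = remainder m2 y + e2' \<longrightarrow>
        folding m1 x = folding m1 y \<and> folding m2 x = folding m2 y)"

definition zeta :: "nat \<Rightarrow> real \<Rightarrow> int \<Rightarrow> int" where
  "zeta K rho d = \<lceil>(rho - of_int (fib_like d K)) / of_int (fib_like d (K + 1))\<rceil>"

definition Gamma1 :: "nat \<Rightarrow> real \<Rightarrow> int \<Rightarrow> int" where
  "Gamma1 K rho d = zeta K rho d * fib_like d (K + 1) + fib_like d K"

definition Gamma2 :: "nat \<Rightarrow> real \<Rightarrow> int \<Rightarrow> int" where
  "Gamma2 K rho d = Gamma1 K rho d + fib_like d (K + 1)"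

lemma fib_like_pos: "d \<ge> 1 \<Longrightarrow> fib_like d k \<ge> 1"
  by (induction d k rule: fib_like.induct) auto

lemma fib_like_le_shift:
  "d \<le> 3 \<Longrightarrow> fib_like d (Suc k) \<le> fib_like 1 (Suc (Suc (Suc k)))"
proof (induction k rule: less_induct)
  case (less k)
  show ?case
  proof (cases k)
    case 0
    then show ?thesis by simp
  next
    case (Suc n)
    show ?thesis
    proof (cases n)
      case 0
      then show ?thesis using Suc less.prems by simp
    next
      case (Suc i)
      with \<open>k = Suc n\<close> have k: "k = Suc (Suc i)" by simp
      have "fib_like d (Suc i) \<le> fib_like 1 (Suc (Suc (Suc i)))"
        and "fib_like d (Suc (Suc i)) \<le> fib_like 1 (Suc (Suc (Suc (Suc i))))"
        using less.IH[of i] less.IH[of "Suc i"] less.prems k by simp_all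
      then show ?thesis unfolding k by simp
    qed
  qed
qed

(* The sequence with seed zeta - 1 requires zeta >= 1.  This can fail for large seeds:
   K = 2, rho = 6, d = 5 gives zeta = 0 and the pair (6, 13), with 13 mod 6 = 1 instead of
   fib_like 5 3 = 7.  It always holds for the seeds 1, 2, 3. *)
lemma zeta_ge_1:
  assumes "K \<ge> 1" "rho > of_int (fib_like 1 (K + 2))" "d \<in> {1..3}"
  shows "zeta K rho d \<ge> 1"
proof -
  obtain k where K: "K = Suc k" using assms(1) by (cases K) auto
  have "fib_like d K \<le> fib_like 1 (K + 2)"
    using fib_like_le_shift[of d k] assms(3) K by simp
  then have "real_of_int (fib_like d K) < rho"
    using assms(2) by linarith
  moreover have "real_of_int (fib_like d (K + 1)) > 0"
    using fib_like_pos[of d "K + 1"] assms(3) by simp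
  ultimately have "(rho - of_int (fib_like d K)) / of_int (fib_like d (K + 1)) > 0"
    by simp
  then show ?thesis unfolding zeta_def by linarith
qed

end

theory Submission
  imports Defs
begin

text \<open>With \<open>v\<^sub>n = (F\<^bsub>\<zeta>,n\<^esub>, F\<^bsub>\<zeta>-1,n\<^esub>)\<close>, consecutive \<open>v\<^sub>n\<close> form a basis of the integer lattice, and
  the linear form \<open>L(a, b) = a \<Gamma>\<^sub>1 - b \<Gamma>\<^sub>2\<close> takes the value \<open>(-1)\<^sup>n \<sigma>\<^sub>n\<close> at \<open>v\<^sub>n\<close>
  for \<open>1 \<le> n \<le> K + 1\<close>.  Two scenarios
  with the same noisy remainders differ in their folding integers by a vector with
  \<open>\<bar>L\<bar> < \<sigma>\<^sub>j\<close>.  As \<open>L\<close> has opposite signs at \<open>v\<^sub>j\<close> and \<open>v\<^sub>j\<^sub>+\<^sub>1\<close>, such a nonnegative nonzero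
  vector dominates \<open>v\<^sub>j\<^sub>+\<^sub>1\<close> in both coordinates (the best approximation property), which pushes
  one of the two signals beyond \<open>P\<^sub>j\<close>.  For \<open>j = K + 1\<close> the kernel vector \<open>(\<Gamma>\<^sub>2, \<Gamma>\<^sub>1)\<close> takes
  the place of \<open>v\<^sub>j\<^sub>+\<^sub>1\<close>.

  For the seed selection, rounding up gives
  \<open>\<Gamma>\<^sub>2(1) < \<rho> + 2 F\<^bsub>1,K+1\<^esub> \<le> \<rho> + F\<^bsub>d,K+1\<^esub> \<le> \<Gamma>\<^sub>2(d)\<close> for all \<open>d \<ge> 4\<close>.\<close>

section \<open>Identities and growth of Fibonacci-like sequences\<close>

text \<open>The recurrence moves one index step from the first factors to the second without
  changing the left side, so induction on \<open>a\<close> with \<open>b\<close> free ends at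
  \<open>a = 0\<close>. For \<open>a + b = K + 1\<close>, the seeds \<open>e = z\<close> and
  \<open>e = z - 1\<close> yield the larger and the smaller modulus.\<close>

lemma fib_like_add:
  "fib_like e (Suc a) * fib_like d (Suc b) + fib_like e a * fib_like d b
     = fib_like d (Suc (a + b)) + e * fib_like d (a + b)"
proof (induction a arbitrary: b)
  case (Suc a)
  from Suc.IH[of "Suc b"] show ?case
    by (simp add: algebra_simps)
qed simp

text \<open>Cassini-type identity: replacing \<open>(v_n, v_{n+1})\<close> by
  \<open>(v_{n+1}, v_{n+1} + v_n)\<close> flips the sign of the determinant, which is
  \<open>z - (z - 1) = 1\<close> at \<open>n = 0\<close>.\<close>

lemma fib_like_det:
  "fib_like z n * fib_like (z - 1) (Suc n) - fib_like z (Suc n) * fib_like (z - 1) n = (-1) ^ n"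
  by (induction n) (simp_all add: algebra_simps)

lemma coprime_fib_like: "coprime (fib_like d k) (fib_like d (Suc k))"
proof (induction k)
  case (Suc k)
  then show ?case
    by (simp add: coprime_iff_gcd_eq_1 gcd.commute[of "fib_like d k"])
qed simp

lemma fib_like_strict_step:
  assumes "d \<ge> 1"
  shows "fib_like d (Suc k) < fib_like d (Suc (Suc k))"
  using fib_like_pos[OF assms, of k] by simp

text \<open>Source of the bound 3 on the seeds: the base cases are \<open>4 \<le> d + 1\<close> and
  \<open>6 \<le> d + 2\<close>, the latter sharp at \<open>d = 4\<close>. At index 1 the inequality
  would read \<open>2 \<le> 1\<close>, so the indices start at 2.\<close>

lemma fib_like_seed_1_le: "4 \<le> d \<Longrightarrow> 2 * fib_like 1 (Suc (Suc k)) \<le> fib_like d (Suc (Suc k))"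
  by (induction k rule: induct_nat_012) auto

section \<open>Best approximation in the integer lattice\<close>

lemma best_approximation:
  fixes p q p' q' A B G1 G2 a b s :: int
  assumes s: "s * s = 1" and det: "p * q' - p' * q = s"
    and pos: "p \<ge> 1" "p' \<ge> 1" "q \<ge> 0" "q' \<ge> 0" "A \<ge> 1" "B \<ge> 0"
    and A: "G1 * p - G2 * q = s * A" and B: "G1 * p' - G2 * q' = - s * B"
    and lt: "\<bar>a * G1 - b * G2\<bar> < A"
    and nonneg: "a \<ge> 0" "b \<ge> 0" and nz: "a \<noteq> 0 \<or> b \<noteq> 0"
  shows "p' \<le> a \<and> q' \<le> b"
proof -
  \<comment> \<open>Coordinates of \<open>(a, b)\<close> in the basis \<open>(p, q)\<close>,
    \<open>(p', q')\<close> by Cramer's rule; multiplying by \<open>s\<close> divides by the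
    determinant, since \<open>s * s = 1\<close>.\<close>
  define u where "u = s * (a * q' - b * p')"
  define v where "v = s * (b * p - a * q)"
  have a: "a = u * p + v * p'"
  proof -
    have "u * p + v * p' = s * (p * q' - p' * q) * a"
      unfolding u_def v_def by (simp add: algebra_simps)
    then show ?thesis using det s by simp
  qed
  have b: "b = u * q + v * q'"
  proof -
    have "u * q + v * q' = s * (p * q' - p' * q) * b"
      unfolding u_def v_def by (simp add: algebra_simps)
    then show ?thesis using det s by simp
  qed
  have "a * G1 - b * G2 = u * (G1 * p - G2 * q) + v * (G1 * p' - G2 * q')"
    unfolding a b by (simp add: algebra_simps)
  also have "\<dots> = s * (u * A - v * B)"
    unfolding A B by (simp add: algebra_simps)
  finally have val: "a * G1 - b * G2 = s * (u * A - v * B)" .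
  have "\<bar>s\<bar> = 1" using s by (auto simp: square_eq_1_iff)
  then have small: "\<bar>u * A - v * B\<bar> < A"
    using lt unfolding val by (simp add: abs_mult)
  \<comment> \<open>If \<open>v \<le> 0\<close>, smallness of the form forces
    \<open>u \<le> 0\<close>, whence \<open>a \<le> u + v \<le> 0\<close>; nonnegativity of
    \<open>a\<close> then leaves only the zero vector.\<close>
  have v: "v \<ge> 1"
  proof (rule ccontr)
    assume "\<not> v \<ge> 1"
    then have v0: "v \<le> 0" by simp
    then have vB: "v * B \<le> 0" using pos by (simp add: mult_nonpos_nonneg)
    have "u \<le> 0"
    proof (rule ccontr)
      assume "\<not> u \<le> 0"
      then have "A \<le> u * A" using pos by (simp add: mult_le_cancel_right1)
      with vB small show False by linarith
    qed
    then have "u * p \<le> u" "v * p' \<le> v"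
      using pos v0 mult_left_mono_neg[of 1 p u] mult_left_mono_neg[of 1 p' v]
      by simp_all
    then have "u = 0 \<and> v = 0" using a nonneg v0 \<open>u \<le> 0\<close> by linarith
    then show False using a b nz by simp
  qed
  have u: "u \<ge> 0"
  proof (rule ccontr)
    assume "\<not> u \<ge> 0"
    then have "u * A \<le> - 1 * A" using pos by (intro mult_right_mono) auto
    moreover have "v * B \<ge> 0" using pos v by simp
    ultimately show False using small by linarith
  qed
  have "0 \<le> u * p" "0 \<le> u * q" "1 * p' \<le> v * p'" "1 * q' \<le> v * q'"
    using u v pos mult_right_mono[of 1 v p'] mult_right_mono[of 1 v q'] by simp_all
  then show ?thesis using a b by linarith
qed

section \<open>From a gap in the lattice to robust recovery\<close>

lemma remainder_eq: "x = of_int (folding M x) * M + remainder M x"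
  by (simp add: remainder_def)

lemma folding_le: "M > 0 \<Longrightarrow> of_int (folding M x) * M \<le> x"
  unfolding folding_def by (rule floor_divide_lower)

lemma folding_mono: "M > 0 \<Longrightarrow> y \<le> x \<Longrightarrow> folding M y \<le> folding M x"
  by (simp add: folding_def floor_mono divide_right_mono)

text \<open>Subtracting two scenarios with equal noisy remainders cancels everything but folding
  differences and errors. The two error bounds of \<open>m * S / 2\<close> add up to
  \<open>m * S\<close>, so the integer form in the folding differences is below
  \<open>S\<close>.\<close>

lemma robust_recovery_if_lattice_gap:
  fixes m :: real and G1 G2 N S :: int
  assumes m: "m > 0" and G: "G1 > 0" "G2 > 0"
    and gap: "\<And>a b. a \<ge> 0 \<Longrightarrow> b \<ge> 0 \<Longrightarrow> a \<noteq> 0 \<or> b \<noteq> 0 \<Longrightarrow> \<bar>a * G1 - b * G2\<bar> < S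
                \<Longrightarrow> N \<le> a * G1 \<or> N \<le> b * G2"
  shows "robust_recovery (m * of_int G1) (m * of_int G2) (m * of_int N)
           (\<lambda>e1 e2. \<bar>e1 - e2\<bar> < m * of_int S / 2)"
proof -
  let ?m1 = "m * of_int G1" and ?m2 = "m * of_int G2"
  have M: "?m1 > 0" "?m2 > 0" using m G by simp_all
  \<comment> \<open>Ordering the signals makes both folding differences nonnegative, as the gap
    condition requires.\<close>
  have ordered: "folding ?m1 x = folding ?m1 y \<and> folding ?m2 x = folding ?m2 y"
    if xy: "0 \<le> y" "y \<le> x" "x < m * of_int N"
      and C: "\<bar>e1 - e2\<bar> < m * of_int S / 2" "\<bar>e1' - e2'\<bar> < m * of_int S / 2"
      and r1: "remainder ?m1 x + e1 = remainder ?m1 y + e1'"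
      and r2: "remainder ?m2 x + e2 = remainder ?m2 y + e2'"
    for x y e1 e2 e1' e2'
  proof (rule ccontr)
    define a where "a = folding ?m1 x - folding ?m1 y"
    define b where "b = folding ?m2 x - folding ?m2 y"
    assume "\<not> ?thesis"
    then have nz: "a \<noteq> 0 \<or> b \<noteq> 0" by (auto simp: a_def b_def)
    have nonneg: "a \<ge> 0" "b \<ge> 0"
      using folding_mono[OF M(1) xy(2)] folding_mono[OF M(2) xy(2)] by (simp_all add: a_def b_def)
    have "x - y = of_int a * ?m1 + (e1' - e1)"
      using remainder_eq[of x ?m1] remainder_eq[of y ?m1] r1
      by (simp add: a_def left_diff_distrib)
    moreover have "x - y = of_int b * ?m2 + (e2' - e2)"
      using remainder_eq[of x ?m2] remainder_eq[of y ?m2] r2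
      by (simp add: b_def left_diff_distrib)
    ultimately have "\<bar>of_int a * ?m1 - of_int b * ?m2\<bar> < m * of_int S"
      using C by linarith
    moreover have "of_int a * ?m1 - of_int b * ?m2 = m * of_int (a * G1 - b * G2)"
      by (simp add: algebra_simps)
    ultimately have "m * of_int \<bar>a * G1 - b * G2\<bar> < m * of_int S"
      using m by (simp add: abs_mult)
    then have "\<bar>a * G1 - b * G2\<bar> < S"
      using m by (simp only: mult_less_cancel_left_pos of_int_less_iff)
    from gap[OF nonneg nz this] consider "N \<le> a * G1" | "N \<le> b * G2" by blast
    then obtain c G where cG: "N \<le> c * G" "m * of_int G > 0"
      and c: "c = folding (m * of_int G) x - folding (m * of_int G) y"
      using M a_def b_def by metis
    \<comment> \<open>Since the smaller signal has a nonnegative folding integer, \<open>c\<close>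
      is at most the folding integer of \<open>x\<close>, and so \<open>c\<close> whole moduli fit
      below \<open>x\<close>.\<close>
    have "0 \<le> folding (m * of_int G) y"
      using xy(1) cG(2) by (simp add: folding_def)
    then have "of_int c * (m * of_int G) \<le> of_int (folding (m * of_int G) x) * (m * of_int G)"
      using cG(2) c by (intro mult_right_mono) auto
    also have "\<dots> \<le> x" by (rule folding_le[OF cG(2)])
    finally have "m * of_int (c * G) \<le> x" by (simp add: algebra_simps)
    moreover have "m * of_int N \<le> m * of_int (c * G)"
      using m cG(1) by (simp only: mult_le_cancel_left_pos of_int_le_iff)
    ultimately show False using xy by linarith
  qed
  show ?thesis
    unfolding robust_recovery_def
  proof (intro ballI allI impI)
    fix x y e1 e2 e1' e2'
    assume x: "x \<in> {0..<m * of_int N}" and y: "y \<in> {0..<m * of_int N}"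
      and C: "\<bar>e1 - e2\<bar> < m * of_int S / 2" "\<bar>e1' - e2'\<bar> < m * of_int S / 2"
      and r: "remainder ?m1 x + e1 = remainder ?m1 y + e1'"
        "remainder ?m2 x + e2 = remainder ?m2 y + e2'"
    show "folding ?m1 x = folding ?m1 y \<and> folding ?m2 x = folding ?m2 y"
    proof (cases "y \<le> x")
      case True
      then show ?thesis using ordered[OF _ True _ C r] x y by simp
    next
      case False
      then show ?thesis using ordered[OF _ _ _ C(2,1) r(1,2)[symmetric]] x y by simp
    qed
  qed
qed

section \<open>Euclidean chain, breakpoints and recovery for one pair\<close>

text \<open>Here \<open>z\<close> abstracts \<open>zeta K rho d\<close>, leaving purely integer
  statements. The bound \<open>z \<ge> 1\<close> keeps the sequence with seed \<open>z - 1\<close>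
  nonnegative and \<open>fib_like d (K + 1)\<close> below \<open>G1\<close>.\<close>

locale fib_pair =
  fixes K :: nat and d z :: int
  assumes K: "K \<ge> 1" and d: "d \<ge> 1" and z: "z \<ge> 1"
begin

definition G1 :: int where "G1 = z * fib_like d (K + 1) + fib_like d K"
definition G2 :: int where "G2 = G1 + fib_like d (K + 1)"

lemma G1_gt: "fib_like d (Suc K) < G1"
proof -
  have "1 * fib_like d (Suc K) \<le> z * fib_like d (Suc K)"
    using z fib_like_pos[OF d, of "Suc K"] by (intro mult_right_mono) auto
  then show ?thesis using fib_like_pos[OF d, of K] by (simp add: G1_def)
qed

lemma G_pos: "G1 > 0" "G2 > 0"
  using G1_gt fib_like_pos[OF d, of "Suc K"] by (auto simp: G2_def)

lemma G_fib_like_add: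
  assumes "a + b = K + 1"
  shows "G1 = fib_like (z - 1) (Suc a) * fib_like d (Suc b) + fib_like (z - 1) a * fib_like d b"
    and "G2 = fib_like z (Suc a) * fib_like d (Suc b) + fib_like z a * fib_like d b"
  unfolding fib_like_add using assms by (simp_all add: G1_def G2_def algebra_simps)

text \<open>After expanding both moduli by the addition formula, the terms with
  \<open>fib_like d b\<close> cancel, and \<open>fib_like d (Suc b)\<close> is multiplied by the
  determinant.\<close>

lemma convergent:
  assumes "n + b = K + 1"
  shows "G1 * fib_like z n - G2 * fib_like (z - 1) n = (-1) ^ n * fib_like d (Suc b)"
  unfolding G_fib_like_add[OF assms] fib_like_det[of z n, symmetric]
  by (simp add: algebra_simps)

text \<open>The Euclidean algorithm runs the recurrence backwards, because the sequence increases
  strictly from index 1 on. The chain stops at \<open>fib_like d 1 = 1\<close>, before the seed,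
  which need not be smaller. The index \<open>b\<close> stands for \<open>K - i\<close>.\<close>

lemma euclid_rem_eq: "i + b = K \<Longrightarrow> euclid_rem G1 G2 (Suc i) = fib_like d (Suc b)"
proof (induction i arbitrary: b rule: induct_nat_012)
  case (0 b)
  then show ?case
    using G1_gt fib_like_pos[OF d, of "Suc K"] by (simp add: G2_def)
next
  case (1 b)
  have b: "K = Suc b" using 1 by simp
  have "euclid_rem G1 G2 (Suc (Suc 0)) = G1 mod (G2 mod G1)" by simp
  also have "G2 mod G1 = fib_like d (Suc K)"
    using G1_gt fib_like_pos[OF d, of "Suc K"] by (simp add: G2_def)
  also have "G1 mod \<dots> = fib_like d K mod fib_like d (Suc K)" by (simp add: G1_def)
  also have "\<dots> = fib_like d (Suc b)"
    using fib_like_pos[OF d, of K] fib_like_strict_step[OF d, of b] unfolding b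
    by (simp del: fib_like.simps)
  finally show ?case .
next
  case (ge2 i b)
  have "euclid_rem G1 G2 (Suc i) = fib_like d (Suc (Suc (Suc b)))"
    and "euclid_rem G1 G2 (Suc (Suc i)) = fib_like d (Suc (Suc b))"
    using ge2.IH(1)[of "Suc (Suc b)"] ge2.IH(2)[of "Suc b"] ge2.prems by auto
  then have "euclid_rem G1 G2 (Suc (Suc (Suc i)))
      = (fib_like d (Suc (Suc b)) + fib_like d (Suc b)) mod fib_like d (Suc (Suc b))"
    by simp
  also have "\<dots> = fib_like d (Suc b)"
    using fib_like_strict_step[OF d, of b] fib_like_pos[OF d, of "Suc b"]
    by (simp del: fib_like.simps)
  finally show ?case .
qed

lemma first_quotient: "euclid_rem G1 G2 0 div euclid_rem G1 G2 (Suc 0) = z"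
proof -
  obtain k where k: "K = Suc k" using K by (cases K) auto
  have "euclid_rem G1 G2 (Suc 0) = fib_like d (Suc K)"
    using euclid_rem_eq[of 0 K] by simp
  moreover have "0 \<le> fib_like d K" "fib_like d K < fib_like d (Suc K)"
    using fib_like_strict_step[OF d, of k] fib_like_pos[OF d, of K] k by auto
  ultimately show ?thesis by (simp add: G1_def)
qed

text \<open>The bound on \<open>i\<close> leaves out the final quotient, which is
  \<open>d + 1\<close>.\<close>

lemma middle_quotient:
  assumes "i + 2 \<le> K"
  shows "euclid_rem G1 G2 (Suc i) div euclid_rem G1 G2 (Suc (Suc i)) = 1"
proof -
  obtain b where b: "K = i + Suc (Suc b)" using assms by (metis add.commute add_2_eq_Suc le_Suc_ex
        add.assoc)
  have "euclid_rem G1 G2 (Suc i) = fib_like d (Suc (Suc b)) + fib_like d (Suc b)"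
    and "euclid_rem G1 G2 (Suc (Suc i)) = fib_like d (Suc (Suc b))"
    using euclid_rem_eq[of i "Suc (Suc b)"] euclid_rem_eq[of "Suc i" "Suc b"] b by auto
  then show ?thesis
    using fib_like_strict_step[OF d, of b] fib_like_pos[OF d, of "Suc b"]
    by (simp del: fib_like.simps)
qed

text \<open>By \<open>convergent\<close>, subtracting the next remainder from \<open>N_{j+1}\<close>
  turns a multiple of one modulus into a multiple of the other. This is the modulus dividing
  \<open>N_j\<close>, so with quotient 1 the sum is one step of the Fibonacci recurrence.\<close>

lemma range_coeff_eq:
  "j \<le> K \<Longrightarrow> range_coeff G1 G2 j =
     (if even j then G2 * fib_like (z - 1) (Suc j) else G1 * fib_like z (Suc j))"
proof (induction j rule: induct_nat_012)
  case 1
  have "range_coeff G1 G2 (Suc 0) = G1 + z * (G2 - fib_like d (Suc K))"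
    unfolding range_coeff.simps first_quotient using euclid_rem_eq[of 0 K] by simp
  then show ?case by (simp add: G2_def algebra_simps)
next
  case (ge2 j)
  define b where "b = K - Suc j"
  have b: "Suc j + b = K" using ge2(3) by (simp add: b_def)
  have "range_coeff G1 G2 (Suc (Suc j))
      = range_coeff G1 G2 j + (range_coeff G1 G2 (Suc j) - fib_like d (Suc b))"
    using middle_quotient[of j] euclid_rem_eq[OF b] ge2(3) by (simp del: euclid_rem.simps)
  moreover have "G1 * fib_like z (Suc (Suc j)) - G2 * fib_like (z - 1) (Suc (Suc j))
      = (-1) ^ j * fib_like d (Suc b)"
    using convergent[of "Suc (Suc j)" b] b by simp
  moreover have "fib_like e (Suc (Suc (Suc j))) = fib_like e (Suc (Suc j)) + fib_like e (Suc j)" for e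
    by simp
  ultimately show ?case
    using ge2 by (cases "even j") (simp_all add: distrib_left del: fib_like.simps range_coeff.simps)
qed simp

lemma range_coeff_last: "range_coeff G1 G2 (K + 1) = G1 * G2"
proof -
  obtain k where k: "K = Suc k" using K by (cases K) auto
  have "euclid_rem G1 G2 (Suc k) = d + 1" "euclid_rem G1 G2 (Suc (Suc k)) = 1"
    using euclid_rem_eq[of k 1] euclid_rem_eq[of "Suc k" 0] k by auto
  then have N: "range_coeff G1 G2 (Suc (Suc k))
      = range_coeff G1 G2 k + (d + 1) * (range_coeff G1 G2 (Suc k) - 1)"
    by (simp del: euclid_rem.simps)
  have conv: "G1 * fib_like z (Suc (Suc k)) - G2 * fib_like (z - 1) (Suc (Suc k)) = (-1) ^ k"
    using convergent[of "Suc (Suc k)" 0] k by simp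
  \<comment> \<open>Addition formula at \<open>b = 1\<close>, where
    \<open>fib_like d 2 = d + 1\<close> is also the last quotient. This weight makes the last sum a
    full product \<open>G1 * G2\<close>.\<close>
  have G: "G1 = fib_like (z - 1) (Suc (Suc k)) * (d + 1) + fib_like (z - 1) (Suc k)"
    "G2 = fib_like z (Suc (Suc k)) * (d + 1) + fib_like z (Suc k)"
    using G_fib_like_add[of "Suc k" 1] k by (simp_all add: add.commute)
  show ?thesis
  proof (cases "even k")
    case True
    have "G1 * G2 = G2 * fib_like (z - 1) (Suc k) + (d + 1) * (G2 * fib_like (z - 1) (Suc (Suc k)))"
      by (subst G(1)) (simp add: algebra_simps del: fib_like.simps)
    also have "G2 * fib_like (z - 1) (Suc (Suc k)) = G1 * fib_like z (Suc (Suc k)) - 1"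
      using conv True by simp
    finally show ?thesis
      using N range_coeff_eq[of k] range_coeff_eq[of "Suc k"] k True
      by (simp del: range_coeff.simps fib_like.simps)
  next
    case False
    have "G1 * G2 = G1 * fib_like z (Suc k) + (d + 1) * (G1 * fib_like z (Suc (Suc k)))"
      by (subst G(2)) (simp add: algebra_simps del: fib_like.simps)
    also have "G1 * fib_like z (Suc (Suc k)) = G2 * fib_like (z - 1) (Suc (Suc k)) - 1"
      using conv False by simp
    finally show ?thesis
      using N range_coeff_eq[of k] range_coeff_eq[of "Suc k"] k False
      by (simp del: range_coeff.simps fib_like.simps)
  qed
qed

lemma fib_like_z_pos: "fib_like z n \<ge> 1" "fib_like (z - 1) n \<ge> 0"
proof -
  show "fib_like z n \<ge> 1" using z by (rule fib_like_pos)
  show "fib_like (z - 1) n \<ge> 0"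
    using z by (induction "z - 1" n rule: fib_like.induct) auto
qed

text \<open>Domination in both coordinates is more than enough: by parity, \<open>N_j\<close> is
  \<open>G1\<close> times the first or \<open>G2\<close> times the second coordinate of the
  dominated vector.\<close>

lemma lattice_gap:
  assumes j: "1 \<le> j" "j \<le> K + 1"
    and ab: "a \<ge> 0" "b \<ge> 0" "a \<noteq> 0 \<or> b \<noteq> 0"
    and lt: "\<bar>a * G1 - b * G2\<bar> < euclid_rem G1 G2 j"
  shows "range_coeff G1 G2 j \<le> a * G1 \<or> range_coeff G1 G2 j \<le> b * G2"
proof -
  obtain i where i: "j = Suc i" using j by (cases j) auto
  define c where "c = K - i"
  have c: "i + c = K" using j i by (simp add: c_def)
  have S: "euclid_rem G1 G2 j = fib_like d (Suc c)"
    unfolding i by (rule euclid_rem_eq[OF c])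
  have sq: "(-1) ^ j * (-1) ^ j = (1::int)" by (simp flip: power_mult_distrib)
  have A: "G1 * fib_like z j - G2 * fib_like (z - 1) j = (-1) ^ j * fib_like d (Suc c)"
    using convergent[of j c] c i by simp
  note lt' = lt[unfolded S]
  show ?thesis
  proof (cases "j = K + 1")
    case True
    then have c0: "c = 0" using c i by simp
    \<comment> \<open>For \<open>c = 0\<close> the remainder is 1, so the value of the form at
      \<open>v_j\<close> is also the determinant of \<open>v_j\<close> and the kernel vector
      \<open>(G2, G1)\<close>.\<close>
    have "G2 \<le> a \<and> G1 \<le> b"
    proof (rule best_approximation[where B = 0 and s = "(-1) ^ j", OF sq _ _ _ _ _ _ _ A _ lt' ab])
      show "fib_like z j * G1 - G2 * fib_like (z - 1) j = (-1) ^ j"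
        using A c0 by (simp add: mult.commute)
    qed (use G_pos fib_like_z_pos[of j] fib_like_pos[OF d, of "Suc c"] in auto)
    then have "G2 * G1 \<le> a * G1" using G_pos by simp
    then show ?thesis using range_coeff_last True by (simp add: mult.commute)
  next
    case False
    with j have jK: "j \<le> K" by simp
    have B: "G1 * fib_like z (Suc j) - G2 * fib_like (z - 1) (Suc j) = - ((-1) ^ j) * fib_like d c"
      using convergent[of "Suc j" "c - 1"] c i jK by (simp del: fib_like.simps)
    have "fib_like z (Suc j) \<le> a \<and> fib_like (z - 1) (Suc j) \<le> b"
      by (rule best_approximation[OF sq fib_like_det _ _ _ _ _ _ A B lt' ab])
        (use fib_like_z_pos[of j] fib_like_z_pos[of "Suc j"] fib_like_pos[OF d, of "Suc c"]
            fib_like_pos[OF d, of c] in auto)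
    then show ?thesis
      using range_coeff_eq[OF jK] G_pos by (simp add: mult.commute)
  qed
qed

lemma robust_recovery_breakpoint:
  assumes "m > 0" "1 \<le> j" "j \<le> K + 1"
  shows "robust_recovery (m * of_int G1) (m * of_int G2) (breakpoint m G1 G2 j)
           (\<lambda>e1 e2. \<bar>e1 - e2\<bar> < m * of_int (euclid_rem G1 G2 j) / 2)"
  unfolding breakpoint_def
  using assms G_pos lattice_gap by (intro robust_recovery_if_lattice_gap) auto

end

section \<open>Coprimality, rounding bounds and comparison of seeds\<close>

lemma coprime_Gamma: "coprime (Gamma1 K rho d) (Gamma2 K rho d)"
proof -
  have "gcd (Gamma1 K rho d) (Gamma2 K rho d) = gcd (Gamma1 K rho d) (fib_like d (Suc K))"
    by (simp add: Gamma2_def)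
  also have "\<dots> = gcd (fib_like d K) (fib_like d (Suc K))"
    using gcd_add_mult[of "fib_like d (Suc K)" "zeta K rho d" "fib_like d K"]
    by (simp add: Gamma1_def gcd.commute)
  also have "\<dots> = 1" using coprime_fib_like by (simp add: coprime_iff_gcd_eq_1)
  finally show ?thesis by (simp add: coprime_iff_gcd_eq_1)
qed

text \<open>The ceiling exceeds its argument by less than 1, hence \<open>Gamma1\<close> exceeds
  \<open>rho\<close> by less than one step \<open>fib_like d (K + 1)\<close>.\<close>

lemma Gamma1_bounds:
  assumes "d \<ge> 1"
  shows "rho \<le> of_int (Gamma1 K rho d)"
    and "of_int (Gamma1 K rho d) < rho + of_int (fib_like d (K + 1))"
proof -
  define F where "F = real_of_int (fib_like d (K + 1))"
  define q where "q = (rho - of_int (fib_like d K)) / F"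
  have F: "F > 0" using fib_like_pos[OF assms, of "K + 1"] by (simp add: F_def)
  have q: "q * F = rho - of_int (fib_like d K)" using F by (simp add: q_def)
  have G: "of_int (Gamma1 K rho d) = of_int \<lceil>q\<rceil> * F + of_int (fib_like d K)"
    by (simp add: Gamma1_def zeta_def q_def F_def)
  have "q * F \<le> of_int \<lceil>q\<rceil> * F" using F by simp
  then show "rho \<le> of_int (Gamma1 K rho d)" using G q by linarith
  have "of_int \<lceil>q\<rceil> * F < (q + 1) * F"
    using F by (intro mult_strict_right_mono) (linarith, simp)
  then show "of_int (Gamma1 K rho d) < rho + of_int (fib_like d (K + 1))"
    using G q unfolding F_def[symmetric] by (simp add: algebra_simps)
qed

lemma Gamma2_seed_1_less:
  assumes "K \<ge> 1" "d > 3"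
  shows "Gamma2 K rho 1 < Gamma2 K rho d"
proof -
  obtain k where "K = Suc k" using assms(1) by (cases K) auto
  then have "2 * fib_like 1 (K + 1) \<le> fib_like d (K + 1)"
    using fib_like_seed_1_le[of d k] assms(2) by simp
  then have "2 * real_of_int (fib_like 1 (K + 1)) \<le> of_int (fib_like d (K + 1))"
    by linarith
  then have "real_of_int (Gamma2 K rho 1) < of_int (Gamma2 K rho d)"
    using Gamma1_bounds(2)[of 1 K rho] Gamma1_bounds(1)[of d rho K] assms(2)
    by (simp add: Gamma2_def del: fib_like.simps)
  then show ?thesis by simp
qed

theorem theorem2:
  fixes K :: nat and m_max N_th rho :: real
  assumes "K \<ge> 1" and "m_max > 0" and "N_th > 0"
    and "rho = N_th / m_max"
    and "rho > of_int (fib_like 1 (K + 2))"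
  shows
    "(\<forall>d \<ge> 1.
        coprime (Gamma1 K rho d) (Gamma2 K rho d)
      \<and> of_int (Gamma1 K rho d) \<ge> rho
      \<and> (zeta K rho d \<ge> 1 \<longrightarrow>
          (\<forall>j. 1 \<le> j \<and> j \<le> K + 1 \<longrightarrow>
             euclid_rem (Gamma1 K rho d) (Gamma2 K rho d) j = fib_like d (K + 2 - j))
        \<and> (\<forall>m > 0.
             (\<forall>j j0. 1 \<le> j \<and> j \<le> K \<longrightarrow>
                (j + 1 = 2 * j0 \<longrightarrow>
                   breakpoint m (Gamma1 K rho d) (Gamma2 K rho d) j
                     = m * of_int (Gamma1 K rho d) * of_int (fib_like (zeta K rho d) (2 * j0)))
              \<and> (j = 2 * j0 \<longrightarrow>
                   breakpoint m (Gamma1 K rho d) (Gamma2 K rho d) j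
                     = m * of_int (Gamma2 K rho d) * of_int (fib_like (zeta K rho d - 1) (2 * j0 + 1))))
           \<and> breakpoint m (Gamma1 K rho d) (Gamma2 K rho d) (K + 1)
               = of_int (Gamma1 K rho d) * of_int (Gamma2 K rho d) * m
           \<and> (\<forall>j. 1 \<le> j \<and> j \<le> K + 1 \<longrightarrow>
                robust_recovery (m * of_int (Gamma1 K rho d)) (m * of_int (Gamma2 K rho d))
                  (breakpoint m (Gamma1 K rho d) (Gamma2 K rho d) j)
                  (\<lambda>e1 e2. \<bar>e1 - e2\<bar>
                     < m * of_int (euclid_rem (Gamma1 K rho d) (Gamma2 K rho d) j) / 2)))))
     \<and> (\<forall>d > 3. Min (Gamma2 K rho ` {1..3}) \<le> Gamma2 K rho d)
     \<and> (\<forall>d_star. is_arg_min (Gamma2 K rho) (\<lambda>d. d \<in> {1..3}) d_star \<longrightarrow>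
            is_arg_min (Gamma2 K rho) (\<lambda>d. d \<ge> 1) d_star
          \<and> is_arg_max (\<lambda>d. m_max / of_int (Gamma2 K rho d)) (\<lambda>d. d \<ge> 1) d_star)"
proof (intro conjI allI impI)
  fix d :: int
  show "coprime (Gamma1 K rho d) (Gamma2 K rho d)" by (rule coprime_Gamma)
  assume d: "d \<ge> 1"
  show "of_int (Gamma1 K rho d) \<ge> rho" by (rule Gamma1_bounds(1)[OF d])
  assume "zeta K rho d \<ge> 1"
  with assms(1) d interpret fib_pair K d "zeta K rho d" by unfold_locales
  have G: "Gamma1 K rho d = G1" "Gamma2 K rho d = G2"
    by (simp_all add: Gamma1_def Gamma2_def G1_def G2_def)
  {
    fix j :: nat
    assume "1 \<le> j \<and> j \<le> K + 1"
    then show "euclid_rem (Gamma1 K rho d) (Gamma2 K rho d) j = fib_like d (K + 2 - j)"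
      \<comment> \<open>With \<open>i = j - 1\<close> and \<open>b = K + 1 - j\<close>, the index
        \<open>Suc b\<close> is \<open>K + 2 - j\<close>.\<close>
      using euclid_rem_eq[of "j - 1" "K + 1 - j"] by (simp add: G Suc_diff_le)
  }
  fix m :: real
  assume m: "m > 0"
  {
    fix j j0 :: nat
    assume j: "1 \<le> j \<and> j \<le> K"
    {
      assume j0: "j + 1 = 2 * j0"
      then have "odd j" by presburger
      then show "breakpoint m (Gamma1 K rho d) (Gamma2 K rho d) j
          = m * of_int (Gamma1 K rho d) * of_int (fib_like (zeta K rho d) (2 * j0))"
        using range_coeff_eq[of j] j j0[symmetric] by (simp add: breakpoint_def G)
    next
      assume "j = 2 * j0"
      then show "breakpoint m (Gamma1 K rho d) (Gamma2 K rho d) j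
          = m * of_int (Gamma2 K rho d) * of_int (fib_like (zeta K rho d - 1) (2 * j0 + 1))"
        using range_coeff_eq[of j] j by (simp add: breakpoint_def G)
    }
  }
  show "breakpoint m (Gamma1 K rho d) (Gamma2 K rho d) (K + 1)
      = of_int (Gamma1 K rho d) * of_int (Gamma2 K rho d) * m"
    unfolding breakpoint_def G range_coeff_last by simp
  fix j :: nat
  assume "1 \<le> j \<and> j \<le> K + 1"
  then show "robust_recovery (m * of_int (Gamma1 K rho d)) (m * of_int (Gamma2 K rho d))
      (breakpoint m (Gamma1 K rho d) (Gamma2 K rho d) j)
      (\<lambda>e1 e2. \<bar>e1 - e2\<bar> < m * of_int (euclid_rem (Gamma1 K rho d) (Gamma2 K rho d) j) / 2)"
    unfolding G using robust_recovery_breakpoint[OF m] by blast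
next
  fix d :: int
  assume "d > 3"
  have "Min (Gamma2 K rho ` {1..3}) \<le> Gamma2 K rho 1" by (intro Min_le) auto
  also have "\<dots> \<le> Gamma2 K rho d"
    using Gamma2_seed_1_less[OF assms(1) \<open>d > 3\<close>, of rho] by simp
  finally show "Min (Gamma2 K rho ` {1..3}) \<le> Gamma2 K rho d" .
next
  fix s :: int
  assume s: "is_arg_min (Gamma2 K rho) (\<lambda>d. d \<in> {1..3}) s"
  have s1: "s \<ge> 1" using s by (auto simp: is_arg_min_def)
  have least: "Gamma2 K rho s \<le> Gamma2 K rho d" if "d \<ge> 1" for d
  proof (cases "d > 3")
    case True
    have "Gamma2 K rho s \<le> Gamma2 K rho 1"
      using s by (auto simp: is_arg_min_def not_less)
    then show ?thesis using Gamma2_seed_1_less[OF assms(1) True, of rho] by simp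
  next
    case False
    then show ?thesis using s that by (auto simp: is_arg_min_def not_less)
  qed
  show "is_arg_min (Gamma2 K rho) (\<lambda>d. d \<ge> 1) s"
    using s1 least by (auto simp: is_arg_min_def not_less)
  \<comment> \<open>Positivity, from \<open>rho > 0\<close>, makes \<open>m_max / Gamma2\<close>
    antitone in \<open>Gamma2\<close>, so that the minimizer of \<open>Gamma2\<close> maximizes the
    scaling factor.\<close>
  have pos: "Gamma2 K rho d > 0" if "d \<ge> 1" for d
  proof -
    have "real_of_int (Gamma1 K rho d) > 0"
      using Gamma1_bounds(1)[OF that, of rho K] divide_pos_pos[OF assms(3,2)] assms(4)
      by linarith
    then show ?thesis using fib_like_pos[OF that, of "K + 1"] by (simp add: Gamma2_def)
  qed
  show "is_arg_max (\<lambda>d. m_max / of_int (Gamma2 K rho d)) (\<lambda>d. d \<ge> 1) s"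
    unfolding is_arg_max_def not_ex
  proof (intro conjI allI notI)
    fix d :: int
    assume "1 \<le> d \<and> m_max / of_int (Gamma2 K rho s) < m_max / of_int (Gamma2 K rho d)"
    then show False
      using least[of d] pos[OF s1] assms(2)
        divide_left_mono[of "of_int (Gamma2 K rho s)" "of_int (Gamma2 K rho d)" m_max]
      by (auto simp: not_less[symmetric] pos)
  qed (use s1 in simp)
qed

end
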